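(* Let $d$ be an IL proof tree with conclusion $[P]\,\mathsf{r}\,[Q]$ and let $P',Q'$ be assertions. If the U-Turn judgment $d\vdash\langle P'\rangle\,\mathsf{r}\,\langle Q'\rangle$ is derivable without using rule (consSIL), then the IL triple $[P']\,\mathsf{r}\,[Q']$ is valid, i.e. $Q'\subseteq[\![\mathsf{r}]\!]P'$.
   Context: Language: atomic commands $\mathsf{c} ::= \mathtt{skip}\mid x:=a\mid b?\mid x:=\mathtt{nondet()}$; regular commands $\mathsf{r}::=\mathsf{c}\mid\mathsf{r};\mathsf{r}\mid\mathsf{r}\boxplus\mathsf{r}\mid\mathsf{r}^*$. States are pairs of a flag in $\{ok,er\}$ and a store $\sigma:\mathrm{Var}\to\mathbb{Z}$. Forward semantics on ok-states: $[\![\mathtt{skip}]\!]\sigma=\{\sigma\}$, $[\![x:=a]\!]\sigma=\{\sigma[x\mapsto[\![a]\!]\sigma]\}$, $[\![b?]\!]\sigma=\{\sigma\}$ if $b$ holds in $\sigma$ else $\varnothing$, $[\![x:=\mathtt{nondet()}]\!]\sigma=\{\sigma[x\mapsto v]\mid v\in\mathbb{Z}\}$ (ok-tagged results); every command maps an er-state $\sigma$ to $\{\sigma\}$; $[\![\mathsf{r}_1;\mathsf{r}_2]\!]\sigma=[\![\mathsf{r}_2]\!]([\![\mathsf{r}_1]\!]\sigma)$, $[\![\mathsf{r}_1\boxplus\mathsf{r}_2]\!]\sigma=[\![\mathsf{r}_1]\!]\sigma\cup[\![\mathsf{r}_2]\!]\sigma$, $[\![\mathsf{r}^*]\!]\sigma=\bigcup_{n\ge0}[\![\mathsf{r}]\!]^n\sigma$;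 lifted to sets by union. Assertions are sets of states; $\land,\lor,\implies,\text{false}$ are intersection, union, inclusion, $\varnothing$. For a set of stores $P$: $ok{:}P$ (resp. $er{:}P$) is the set of ok- (resp. er-)tagged states with store in $P$; $P[a/x]=\{\sigma\mid\sigma[x\mapsto[\![a]\!]\sigma]\in P\}$; $\exists x.P=\{\sigma[x\mapsto v]\mid\sigma\in P,v\in\mathbb{Z}\}$; $\mathrm{sp}_{x:=a}(P)=\{\sigma[x\mapsto[\![a]\!]\sigma]\mid\sigma\in P\}$. IL proof trees are built from: (assign) $[ok{:}P]\,x:=a\,[ok{:}\mathrm{sp}_{x:=a}(P)]$; (assume) $[ok{:}P]\,b?\,[ok{:}P\land b]$; (nondet) $[ok{:}P]\,x:=\mathtt{nondet()}\,[ok{:}\exists x.P]$; (skip) $[ok{:}P]\,\mathtt{skip}\,[ok{:}P]$; (er-id) $[er{:}P]\,\mathsf{r}\,[er{:}P]$; (disj) from $[P_1]\mathsf{r}[Q_1]$, $[P_2]\mathsf{r}[Q_2]$ infer $[P_1\lor P_2]\mathsf{r}[Q_1\lor Q_2]$; (cons) from $[P']\mathsf{r}[Q']$ with $P'\implies P$, $Q\implies Q'$ infer $[P]\mathsf{r}[Q]$; (seq) from $[P]\mathsf{r}_1[R]$, $[R]\mathsf{r}_2[Q]$ infer $[P]\mathsf{r}_1;\mathsf{r}_2[Q]$; (choiceL/R) from $[P]\mathsf{r}_i[Q]$ infer $[P]\mathsf{r}_1\boxplus\mathsf{r}_2[Q]$; (iter0) $[P]\mathsf{r}^*[P]$; (unroll)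 from $[P]\mathsf{r}^*;\mathsf{r}[Q]$ infer $[P]\mathsf{r}^*[Q]$. U-Turn judgments $d\vdash\langle P'\rangle\mathsf{r}\langle Q'\rangle$ ($d$ an IL proof tree concluding some $[P]\mathsf{r}[Q]$) are derived by the rules: (assign) if $d$ is the axiom $[ok{:}P]x:=a[ok{:}\mathrm{sp}_{x:=a}(P)]$ and $Q'\implies\mathrm{sp}_{x:=a}(P)$, then $d\vdash\langle ok{:}P\land Q'[a/x]\rangle x:=a\langle ok{:}Q'\rangle$; (nondet) if $d$ is the axiom $[ok{:}P]x:=\mathtt{nondet()}[ok{:}\exists x.P]$ and $Q'\implies\exists x.P$, then $d\vdash\langle ok{:}P\land\exists x.Q'\rangle x:=\mathtt{nondet()}\langle ok{:}Q'\rangle$; (assume) if $d$ is the axiom $[ok{:}P]b?[ok{:}P\land b]$ and $Q'\implies P\land b$, then $d\vdash\langle ok{:}Q'\rangle b?\langle ok{:}Q'\rangle$; (skip) if $d$ is the skip axiom with pre/post $P$ and $Q'\implies P$, then $d\vdash\langle Q'\rangle\mathtt{skip}\langle Q'\rangle$; (er-id) if $d$ is $[er{:}P]\mathsf{r}[er{:}P]$ and $Q'\implies P$, then $d\vdash\langle er{:}Q'\rangle\mathsf{r}\langle er{:}Q'\rangle$; (empty) for any $d$, $d\vdash\langle\text{false}\rangle\mathsf{r}\langle\text{false}\rangle$; (disj) if $d$ ends with IL (disj) with subtrees $d_1,d_2$ and $d_i\vdash\langle P_i'\rangle\mathsf{r}\langle Q_i'\rangle$, then $d\vdash\langle P_1'\lor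 P_2'\rangle\mathsf{r}\langle Q_1'\lor Q_2'\rangle$; (seq) if $d$ ends with IL (seq) with subtrees $d_1,d_2$ and $d_1\vdash\langle P'\rangle\mathsf{r}_1\langle R'\rangle$, $d_2\vdash\langle R'\rangle\mathsf{r}_2\langle Q'\rangle$, then $d\vdash\langle P'\rangle\mathsf{r}_1;\mathsf{r}_2\langle Q'\rangle$; (choiceL/R) if $d$ ends with IL (choiceL)/(choiceR) with subtree $d'$ and $d'\vdash\langle P'\rangle\mathsf{r}_i\langle Q'\rangle$, then $d\vdash\langle P'\rangle\mathsf{r}_1\boxplus\mathsf{r}_2\langle Q'\rangle$; (iter0) if $d$ is $[P]\mathsf{r}^*[P]$ and $Q'\implies P$, then $d\vdash\langle Q'\rangle\mathsf{r}^*\langle Q'\rangle$; (unroll) if $d$ ends with IL (unroll) with subtree $d'$ and $d'\vdash\langle P'\rangle\mathsf{r}^*;\mathsf{r}\langle Q'\rangle$, then $d\vdash\langle P'\rangle\mathsf{r}^*\langle Q'\rangle$; (consIL) if $d$ ends with IL (cons) concluding $[P]\mathsf{r}[Q]$ from subtree $d'$, $d'\vdash\langle P''\rangle\mathsf{r}\langle Q''\rangle$ and $Q''\implies Q$, then $d\vdash\langle P''\rangle\mathsf{r}\langle Q''\rangle$; (consSIL) if $d$ concludes $[P]\mathsf{r}[Q]$, $d\vdash\langle P''\rangle\mathsf{r}\langle Q''\rangle$, $\text{false}\not\equiv P'\implies P''$ and $Q''\implies Q'\implies Q$, then $d\vdash\langle P'\rangle\mathsf{r}\langle Q'\rangle$.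 *)

theory Defs
  imports Main
begin

text \<open>
  Variables range over an arbitrary type. The syntax of expressions is left unspecified in the
  mathematics and only their values matter, so an arithmetic (Boolean) expression is represented by
  its denotation; every concrete expression language is covered by its evaluation function.
\<close>

type_synonym 'v store = "'v \<Rightarrow> int"
type_synonym 'v aexp = "'v store \<Rightarrow> int"
type_synonym 'v bexp = "'v store \<Rightarrow> bool"

datatype 'v acmd =
    Skip
  | Assign 'v "'v aexp"
  | Assume "'v bexp"
  | Nondet 'v

datatype 'v reg =
    Atom "'v acmd"
  | Seq "'v reg" "'v reg"
  | Choice "'v reg" "'v reg"
  | Star "'v reg"

datatype flag = Ok | Er

type_synonym 'v state = "flag \<times> 'v store"
type_synonym 'v assertion = "'v state set"

primrec acmd_sem :: "'v acmd \<Rightarrow> 'v store \<Rightarrow> 'v store set" where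
  "acmd_sem Skip \<sigma> = {\<sigma>}"
| "acmd_sem (Assign x a) \<sigma> = {\<sigma>(x := a \<sigma>)}"
| "acmd_sem (Assume b) \<sigma> = (if b \<sigma> then {\<sigma>} else {})"
| "acmd_sem (Nondet x) \<sigma> = {\<sigma>(x := v) | v. True}"

text \<open>
  Only atomic commands treat error states explicitly; that every regular command maps an error state
  to its own singleton is the lemma \<open>sem_Er\<close> below.
\<close>

primrec sem :: "'v reg \<Rightarrow> 'v state \<Rightarrow> 'v state set" where
  "sem (Atom c) s = (case s of (Ok, \<sigma>) \<Rightarrow> Pair Ok ` acmd_sem c \<sigma> | (Er, \<sigma>) \<Rightarrow> {(Er, \<sigma>)})"
| "sem (Seq r1 r2) s = (\<Union>t \<in> sem r1 s. sem r2 t)"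
| "sem (Choice r1 r2) s = sem r1 s \<union> sem r2 s"
| "sem (Star r) s = (\<Union>n. ((\<lambda>X. \<Union>t \<in> X. sem r t) ^^ n) {s})"

lemma sem_Er: "sem r (Er, \<sigma>) = {(Er, \<sigma>)}"
proof (induction r)
  case (Star r)
  have "((\<lambda>X. \<Union>t \<in> X. sem r t) ^^ n) {(Er, \<sigma>)} = {(Er, \<sigma>)}" for n
    by (induction n) (simp_all add: Star.IH)
  then show ?case by simp
qed simp_all

definition post :: "'v reg \<Rightarrow> 'v assertion \<Rightarrow> 'v assertion" where
  "post r P = (\<Union>s \<in> P. sem r s)"

definition il_valid :: "'v assertion \<Rightarrow> 'v reg \<Rightarrow> 'v assertion \<Rightarrow> bool" where
  "il_valid P r Q \<longleftrightarrow> Q \<subseteq> post r P"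

definition ok :: "'v store set \<Rightarrow> 'v assertion" where
  "ok P = {(Ok, \<sigma>) | \<sigma>. \<sigma> \<in> P}"

definition er :: "'v store set \<Rightarrow> 'v assertion" where
  "er P = {(Er, \<sigma>) | \<sigma>. \<sigma> \<in> P}"

definition subst :: "'v store set \<Rightarrow> 'v aexp \<Rightarrow> 'v \<Rightarrow> 'v store set" where
  "subst P a x = {\<sigma>. \<sigma>(x := a \<sigma>) \<in> P}"

definition exvar :: "'v \<Rightarrow> 'v store set \<Rightarrow> 'v store set" where
  "exvar x P = {\<sigma>(x := v) | \<sigma> v. \<sigma> \<in> P}"

definition sp :: "'v \<Rightarrow> 'v aexp \<Rightarrow> 'v store set \<Rightarrow> 'v store set" where
  "sp x a P = {\<sigma>(x := a \<sigma>) | \<sigma>. \<sigma> \<in> P}"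

text \<open>
  Raw proof trees: one constructor per rule of incorrectness logic, annotated with the parts of the
  conclusion that the subtrees do not determine. \<open>il_proof d P r Q\<close> says that \<open>d\<close> is a
  well-formed proof tree with conclusion \<open>[P] r [Q]\<close>; a raw tree has at most one conclusion.
\<close>

datatype 'v il_tree =
    IL_Assign "'v store set" 'v "'v aexp"
  | IL_Assume "'v store set" "'v bexp"
  | IL_Nondet "'v store set" 'v
  | IL_Skip "'v store set"
  | IL_ErId "'v store set" "'v reg"
  | IL_Disj "'v il_tree" "'v il_tree"
  | IL_Cons "'v assertion" "'v il_tree" "'v assertion"
  | IL_Seq "'v il_tree" "'v il_tree"
  | IL_ChoiceL "'v il_tree" "'v reg"
  | IL_ChoiceR "'v reg" "'v il_tree"
  | IL_Iter0 "'v assertion" "'v reg"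
  | IL_Unroll "'v il_tree"

inductive il_proof :: "'v il_tree \<Rightarrow> 'v assertion \<Rightarrow> 'v reg \<Rightarrow> 'v assertion \<Rightarrow> bool" where
  assign: "il_proof (IL_Assign P x a) (ok P) (Atom (Assign x a)) (ok (sp x a P))"
| assume_cmd: "il_proof (IL_Assume P b) (ok P) (Atom (Assume b)) (ok (P \<inter> {\<sigma>. b \<sigma>}))"
| nondet: "il_proof (IL_Nondet P x) (ok P) (Atom (Nondet x)) (ok (exvar x P))"
| skip: "il_proof (IL_Skip P) (ok P) (Atom Skip) (ok P)"
| er_id: "il_proof (IL_ErId P r) (er P) r (er P)"
| disj: "il_proof d1 P1 r Q1 \<Longrightarrow> il_proof d2 P2 r Q2 \<Longrightarrow>
    il_proof (IL_Disj d1 d2) (P1 \<union> P2) r (Q1 \<union> Q2)"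
| conseq: "il_proof d P' r Q' \<Longrightarrow> P' \<subseteq> P \<Longrightarrow> Q \<subseteq> Q' \<Longrightarrow>
    il_proof (IL_Cons P d Q) P r Q"
| seq: "il_proof d1 P r1 R \<Longrightarrow> il_proof d2 R r2 Q \<Longrightarrow>
    il_proof (IL_Seq d1 d2) P (Seq r1 r2) Q"
| choiceL: "il_proof d P r1 Q \<Longrightarrow> il_proof (IL_ChoiceL d r2) P (Choice r1 r2) Q"
| choiceR: "il_proof d P r2 Q \<Longrightarrow> il_proof (IL_ChoiceR r1 d) P (Choice r1 r2) Q"
| iter0: "il_proof (IL_Iter0 P r) P (Star r) P"
| unroll: "il_proof d P (Seq (Star r) r) Q \<Longrightarrow> il_proof (IL_Unroll d) P (Star r) Q"

text \<open>
  \<open>uturn sil d P' r Q'\<close> is derivability of the U-Turn judgment, where the rule consSIL is available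
  iff \<open>sil\<close> holds. The \<open>il_proof\<close> premises make sure that \<open>d\<close> is a well-formed proof tree
  for \<open>r\<close>; they are absent where this already follows from the other premises.
\<close>

inductive uturn ::
  "bool \<Rightarrow> 'v il_tree \<Rightarrow> 'v assertion \<Rightarrow> 'v reg \<Rightarrow> 'v assertion \<Rightarrow> bool" for sil where
  assign: "Q' \<subseteq> sp x a P \<Longrightarrow>
    uturn sil (IL_Assign P x a) (ok (P \<inter> subst Q' a x)) (Atom (Assign x a)) (ok Q')"
| nondet: "Q' \<subseteq> exvar x P \<Longrightarrow>
    uturn sil (IL_Nondet P x) (ok (P \<inter> exvar x Q')) (Atom (Nondet x)) (ok Q')"
| assume_cmd: "Q' \<subseteq> P \<inter> {\<sigma>. b \<sigma>} \<Longrightarrow>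
    uturn sil (IL_Assume P b) (ok Q') (Atom (Assume b)) (ok Q')"
| skip: "Q' \<subseteq> P \<Longrightarrow> uturn sil (IL_Skip P) (ok Q') (Atom Skip) (ok Q')"
| er_id: "Q' \<subseteq> P \<Longrightarrow> uturn sil (IL_ErId P r) (er Q') r (er Q')"
| empty: "il_proof d P r Q \<Longrightarrow> uturn sil d {} r {}"
| disj: "uturn sil d1 P1' r Q1' \<Longrightarrow> uturn sil d2 P2' r Q2' \<Longrightarrow>
    uturn sil (IL_Disj d1 d2) (P1' \<union> P2') r (Q1' \<union> Q2')"
| seq: "il_proof (IL_Seq d1 d2) P (Seq r1 r2) Q \<Longrightarrow>
    uturn sil d1 P' r1 R' \<Longrightarrow> uturn sil d2 R' r2 Q' \<Longrightarrow>
    uturn sil (IL_Seq d1 d2) P' (Seq r1 r2) Q'"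
| choiceL: "uturn sil d P' r1 Q' \<Longrightarrow> uturn sil (IL_ChoiceL d r2) P' (Choice r1 r2) Q'"
| choiceR: "uturn sil d P' r2 Q' \<Longrightarrow> uturn sil (IL_ChoiceR r1 d) P' (Choice r1 r2) Q'"
| iter0: "Q' \<subseteq> P \<Longrightarrow> uturn sil (IL_Iter0 P r) Q' (Star r) Q'"
| unroll: "uturn sil d P' (Seq (Star r) r) Q' \<Longrightarrow> uturn sil (IL_Unroll d) P' (Star r) Q'"
| consIL: "il_proof (IL_Cons P d Q) P r Q \<Longrightarrow> uturn sil d P'' r Q'' \<Longrightarrow> Q'' \<subseteq> Q \<Longrightarrow>
    uturn sil (IL_Cons P d Q) P'' r Q''"
| consSIL: "sil \<Longrightarrow> il_proof d P r Q \<Longrightarrow> uturn sil d P'' r Q'' \<Longrightarrow>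
    P' \<noteq> {} \<Longrightarrow> P' \<subseteq> P'' \<Longrightarrow> Q'' \<subseteq> Q' \<Longrightarrow> Q' \<subseteq> Q \<Longrightarrow>
    uturn sil d P' r Q'"

abbreviation uturn_derivable ::
  "'v il_tree \<Rightarrow> 'v assertion \<Rightarrow> 'v reg \<Rightarrow> 'v assertion \<Rightarrow> bool" where
  "uturn_derivable \<equiv> uturn True"

abbreviation uturn_derivable_without_consSIL ::
  "'v il_tree \<Rightarrow> 'v assertion \<Rightarrow> 'v reg \<Rightarrow> 'v assertion \<Rightarrow> bool" where
  "uturn_derivable_without_consSIL \<equiv> uturn False"

end

theory Submission
  imports Defs
begin

lemma post_Un: "post r (P \<union> Q) = post r P \<union> post r Q"
  by (simp add: post_def)

lemma post_Seq: "post (Seq r1 r2) P = post r2 (post r1 P)"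
  by (simp add: post_def)

lemma post_Choice: "post (Choice r1 r2) P = post r1 P \<union> post r2 P"
  by (auto simp: post_def)

lemma post_mono: "P \<subseteq> P' \<Longrightarrow> post r P \<subseteq> post r P'"
  by (auto simp: post_def)

lemma post_er: "post r (er P) = er P"
  by (auto simp: post_def er_def sem_Er)

text \<open>Atomic commands keep the \<open>Ok\<close> flag, so together with \<open>ok_mono\<close>
  the atomic rules reduce to inclusions between sets of stores.\<close>

lemma post_Atom_ok: "post (Atom c) (ok P) = ok (\<Union>\<sigma> \<in> P. acmd_sem c \<sigma>)"
  by (auto simp: post_def ok_def)

lemma ok_mono: "P \<subseteq> P' \<Longrightarrow> ok P \<subseteq> ok P'"
  by (auto simp: ok_def)

lemma subset_post_Star: "P \<subseteq> post (Star r) P"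
proof
  fix s assume "s \<in> P"
  \<comment> \<open>Zero iterations: the index 0 is the witness for the union over n.\<close>
  moreover have "s \<in> ((\<lambda>X. \<Union>t \<in> X. sem r t) ^^ 0) {s}"
    by simp
  then have "s \<in> sem (Star r) s"
    unfolding sem.simps by blast
  ultimately show "s \<in> post (Star r) P"
    unfolding post_def by blast
qed

text \<open>One run of \<open>r\<close> after n iterations is the iterate with index
  \<open>Suc n\<close>.\<close>

lemma sem_Star_unroll: "sem (Seq (Star r) r) s \<subseteq> sem (Star r) s"
proof
  let ?F = "\<lambda>X. \<Union>t \<in> X. sem r t"
  fix u assume "u \<in> sem (Seq (Star r) r) s"
  then obtain n where "u \<in> ?F ((?F ^^ n) {s})"
    by auto
  then have "u \<in> (?F ^^ Suc n) {s}"
    by simp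
  then show "u \<in> sem (Star r) s"
    unfolding sem.simps by blast
qed

lemma post_Star_unroll: "post (Seq (Star r) r) P \<subseteq> post (Star r) P"
  unfolding post_def using sem_Star_unroll by blast

text \<open>
  A store of \<open>Q'\<close> has the form \<open>\<sigma>(x := v)\<close> with \<open>\<sigma> \<in> P\<close>, and restoring the old value of
  \<open>x\<close> shows that \<open>\<sigma>\<close> itself survives the restriction to \<open>exvar x Q'\<close>.
\<close>

lemma subset_Nondet_exvar:
  assumes "Q' \<subseteq> exvar x P"
  shows "Q' \<subseteq> (\<Union>\<sigma> \<in> P \<inter> exvar x Q'. acmd_sem (Nondet x) \<sigma>)"
proof
  fix \<tau> assume "\<tau> \<in> Q'"
  then obtain \<sigma> v where \<sigma>: "\<sigma> \<in> P" "\<tau> = \<sigma>(x := v)"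
    using assms by (auto simp: exvar_def)
  then have "\<sigma> = \<tau>(x := \<sigma> x)"
    by simp
  with \<open>\<tau> \<in> Q'\<close> have "\<sigma> \<in> exvar x Q'"
    unfolding exvar_def by blast
  with \<sigma> show "\<tau> \<in> (\<Union>\<sigma> \<in> P \<inter> exvar x Q'. acmd_sem (Nondet x) \<sigma>)"
    by auto
qed

text \<open>Only consSIL shrinks the precondition or enlarges the postcondition of a derived
  judgment, and either change can break the inclusion.\<close>

lemma uturn_without_consSIL_sound:
  assumes "uturn_derivable_without_consSIL d P' r Q'"
  shows "Q' \<subseteq> post r P'"
  using assms
proof (induction rule: uturn.induct)
  case (assign Q' x a P)
  then show ?case
    \<comment> \<open>A store of \<open>Q'\<close> is \<open>\<sigma>(x := a \<sigma>)\<close> for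
      some \<sigma> in \<open>P\<close>, and this \<sigma> lies in \<open>subst Q' a x\<close> by
      definition.\<close>
    unfolding post_Atom_ok by (intro ok_mono) (auto simp: sp_def subst_def)
next
  case (nondet Q' x P)
  then show ?case
    unfolding post_Atom_ok by (intro ok_mono subset_Nondet_exvar)
next
  case (assume_cmd Q' P b)
  then show ?case
    unfolding post_Atom_ok by (intro ok_mono) auto
next
  case (skip Q' P)
  then show ?case
    unfolding post_Atom_ok by (intro ok_mono) auto
next
  case (seq d1 d2 P r1 r2 Q P' R' Q')
  then show ?case
    \<comment> \<open>\<open>Q'\<close> lies in \<open>post r2 R'\<close>, and monotonicity replaces
      \<open>R'\<close> by the larger \<open>post r1 P'\<close>.\<close>
    unfolding post_Seq using post_mono by blast
next
  case (unroll d P' r Q')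
  then show ?case
    using post_Star_unroll by blast
\<comment> \<open>The consSIL case is vacuous, since its premise \<open>sil\<close> is
  \<open>False\<close> here.\<close>
qed (auto simp: post_er post_Un post_Choice subset_post_Star)

theorem theorem4p7:
  fixes d :: "'v il_tree" and r :: "'v reg" and P Q P' Q' :: "'v assertion"
  assumes "il_proof d P r Q"
    and "uturn_derivable_without_consSIL d P' r Q'"
  shows "il_valid P' r Q'"
  using uturn_without_consSIL_sound[OF assms(2)] by (simp add: il_valid_def)

end
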